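(* Let $n \geq 8$ and let $G = CS_{7,n-7}$ be the cycle-star graph with cycle length $k=7$ and $n-k \geq 1$ pendant vertices. Then $es(G) = n-3$ if $n = 8$; $es(G) = n-4$ if $n \in \{9,10\}$; and $es(G) = n-5$ if $n \geq 11$.
   Context: For integers $k \geq 3$ and $n > k$, the cycle-star graph $CS_{k,n-k}$ is the simple graph on $n$ vertices consisting of a cycle of length $k$ together with $n-k$ additional vertices of degree one (leaves), all adjacent to the same single vertex of the cycle. For a simple graph $G$, a vertex $k$-labeling is a map $\phi: V(G) \to \{1,2,\ldots,k\}$; the weight of an edge $uv$ is $w_\phi(uv) = \phi(u)+\phi(v)$. The labeling is an edge irregular $k$-labeling if distinct edges have distinct weights. The edge irregularity strength $es(G)$ is the minimum $k$ for which $G$ admits an edge irregular $k$-labeling. *)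

theory Defs
  imports Main
begin

text \<open>A simple graph is a pair of a vertex set and a set of edges, each edge being
  the two-element set of its endpoints.\<close>

type_synonym 'a graph = "'a set \<times> 'a set set"

definition simple_graph :: "'a graph \<Rightarrow> bool" where
  "simple_graph G \<longleftrightarrow> (\<forall>e \<in> snd G. e \<subseteq> fst G \<and> card e = 2)"

definition vertex_labeling :: "'a graph \<Rightarrow> nat \<Rightarrow> ('a \<Rightarrow> nat) \<Rightarrow> bool" where
  "vertex_labeling G k \<phi> \<longleftrightarrow> (\<forall>v \<in> fst G. \<phi> v \<in> {1..k})"

definition edge_weight :: "('a \<Rightarrow> nat) \<Rightarrow> 'a set \<Rightarrow> nat" where
  "edge_weight \<phi> e = (\<Sum>v\<in>e. \<phi> v)"

lemma edge_weight_edge: "u \<noteq> v \<Longrightarrow> edge_weight \<phi> {u, v} = \<phi> u + \<phi> v"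
  by (simp add: edge_weight_def)

definition edge_irregular_labeling :: "'a graph \<Rightarrow> nat \<Rightarrow> ('a \<Rightarrow> nat) \<Rightarrow> bool" where
  "edge_irregular_labeling G k \<phi> \<longleftrightarrow>
     vertex_labeling G k \<phi> \<and> inj_on (edge_weight \<phi>) (snd G)"

text \<open>For finite simple graphs an edge irregular labeling always exists (label the
  vertices by distinct powers of 2), so the minimum below is attained.\<close>

definition es :: "'a graph \<Rightarrow> nat" where
  "es G = (LEAST k. \<exists>\<phi>. edge_irregular_labeling G k \<phi>)"

text \<open>The graph with a cycle of length \<open>k\<close> on the vertices \<open>0, \<dots>, k - 1\<close> and \<open>m\<close> leaves
  \<open>k, \<dots>, k + m - 1\<close>, all attached to the cycle vertex \<open>0\<close>; it is meant for \<open>k \<ge> 3\<close>.\<close>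

definition cycle_star :: "nat \<Rightarrow> nat \<Rightarrow> nat graph" where
  "cycle_star k m =
     ({..<k + m},
      {{i, (i + 1) mod k} | i. i < k} \<union> {{0, j} | j. k \<le> j \<and> j < k + m})"

lemma simple_graph_cycle_star:
  assumes "k \<ge> 3"
  shows "simple_graph (cycle_star k m)"
  unfolding simple_graph_def
proof
  fix e assume "e \<in> snd (cycle_star k m)"
  then consider (cycle) i where "i < k" "e = {i, (i + 1) mod k}"
    | (leaf) j where "k \<le> j" "j < k + m" "e = {0, j}"
    unfolding cycle_star_def snd_conv by blast
  then show "e \<subseteq> fst (cycle_star k m) \<and> card e = 2"
  proof cases
    case cycle
    have "i \<noteq> (i + 1) mod k \<and> (i + 1) mod k < k + m"
    proof (cases "i + 1 = k")
      case True
      then show ?thesis using assms by simp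
    next
      case False
      then have "i + 1 < k" using cycle by linarith
      then show ?thesis by simp
    qed
    then show ?thesis using cycle by (simp add: cycle_star_def trans_less_add1)
  next
    case leaf
    then show ?thesis using assms by (simp add: cycle_star_def)
  qed
qed

lemma card_vertices_cycle_star: "card (fst (cycle_star k m)) = k + m"
  by (simp add: cycle_star_def)

end

theory Submission
  imports Defs "HOL-Library.Nat_Bijection"
begin

text \<open>Lower bounds: the edges at the centre force its \<open>n - 5\<close> neighbours to carry distinct labels,
  so \<open>es \<ge> n - 5\<close>; all \<open>n\<close> edge weights lie in \<open>{2..2 * es}\<close>, so \<open>2 * es \<ge> n + 1\<close>. The second bound
  is the stronger one exactly for \<open>n \<le> 10\<close>.

  Upper bounds: around the cycle, starting at the centre, the labels \<open>6, 5, 1, 1, 2, 2, 3\<close> put the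
  edges away from the centre on the weights \<open>2, \<dots>, 6\<close>, leaving \<open>7, 8, \<dots>\<close> for the edges at the
  centre; the leaves take the labels other than \<open>3\<close> and \<open>5\<close> in increasing order. For \<open>n \<le> 9\<close> the
  cycle labels \<open>3, 5, 5, 4, 2, 1, 1\<close> and leaf labels \<open>2, 4\<close> use only labels up to \<open>5\<close>.\<close>

lemma simple_graph_edgeE:
  assumes "simple_graph G" "e \<in> snd G"
  obtains u v where "e = {u, v}" "u \<noteq> v" "u \<in> fst G" "v \<in> fst G"
proof -
  from assms have "e \<subseteq> fst G" "card e = 2"
    by (simp_all add: simple_graph_def)
  with that show thesis
    by (auto simp: card_2_iff)
qed

lemma ex_edge_irregular_labeling:
  assumes "finite (fst G)" "simple_graph G"
  shows "\<exists>k \<phi>. edge_irregular_labeling G k \<phi>"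
proof -
  obtain f :: "'a \<Rightarrow> nat" where inj_f: "inj_on f (fst G)"
    using finite_imp_inj_to_nat_seg[OF assms(1)] by blast
  define \<phi> :: "'a \<Rightarrow> nat" where "\<phi> v = 2 ^ f v" for v
  have edge_subset: "e \<subseteq> fst G" if "e \<in> snd G" for e
    using assms(2) that by (simp add: simple_graph_def)
  have weight_eq: "edge_weight \<phi> e = set_encode (f ` e)" if "e \<in> snd G" for e
    using inj_on_subset[OF inj_f edge_subset[OF that]]
    by (simp add: edge_weight_def set_encode_def \<phi>_def sum.reindex)
  have "inj_on (edge_weight \<phi>) (snd G)"
  proof (rule inj_onI)
    fix d e assume edges: "d \<in> snd G" "e \<in> snd G" and "edge_weight \<phi> d = edge_weight \<phi> e"
    then have "set_encode (f ` d) = set_encode (f ` e)"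
      by (simp add: weight_eq)
    moreover have "finite d" "finite e"
      using edges edge_subset finite_subset assms(1) by blast+
    ultimately have "f ` d = f ` e"
      by (simp add: set_encode_eq)
    then show "d = e"
      using inj_on_image_eq_iff[OF inj_f] edges edge_subset by simp
  qed
  moreover have "vertex_labeling G (Max (\<phi> ` fst G)) \<phi>"
    using assms(1) by (simp add: vertex_labeling_def \<phi>_def)
  ultimately show ?thesis
    unfolding edge_irregular_labeling_def by blast
qed

lemma es_le:
  assumes "edge_irregular_labeling G k \<phi>"
  shows "es G \<le> k"
  unfolding es_def using assms by (blast intro: Least_le)

lemma es_labelingE:
  assumes "finite (fst G)" "simple_graph G"
  obtains \<phi> where "vertex_labeling G (es G) \<phi>" "inj_on (edge_weight \<phi>) (snd G)"
  using LeastI_ex[OF ex_edge_irregular_labeling[OF assms]] that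
  unfolding es_def edge_irregular_labeling_def by blast

lemma edge_weight_bounds:
  assumes "simple_graph G" "vertex_labeling G k \<phi>" "e \<in> snd G"
  shows "edge_weight \<phi> e \<in> {2..2 * k}"
proof -
  obtain u v where "e = {u, v}" "u \<noteq> v" and uv: "u \<in> fst G" "v \<in> fst G"
    using assms(1,3) by (rule simple_graph_edgeE)
  then have "edge_weight \<phi> e = \<phi> u + \<phi> v"
    by (simp add: edge_weight_edge)
  moreover have "\<phi> u \<in> {1..k}" "\<phi> v \<in> {1..k}"
    using assms(2) uv by (simp_all add: vertex_labeling_def)
  ultimately show ?thesis
    by simp
qed

theorem card_edges_le_es:
  assumes "finite (fst G)" "simple_graph G"
  shows "card (snd G) \<le> 2 * es G - 1"
proof -
  obtain \<phi> where "vertex_labeling G (es G) \<phi>" and inj: "inj_on (edge_weight \<phi>) (snd G)"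
    using assms by (rule es_labelingE)
  then have "edge_weight \<phi> ` snd G \<subseteq> {2..2 * es G}"
    using edge_weight_bounds[OF assms(2)] by blast
  with inj have "card (snd G) \<le> card {2..2 * es G}"
    by (intro card_inj_on_le) simp_all
  then show ?thesis
    by simp
qed

definition neighbours :: "'a graph \<Rightarrow> 'a \<Rightarrow> 'a set" where
  "neighbours G c = {v. {c, v} \<in> snd G}"

lemma neighbours_simple_graph:
  assumes "simple_graph G" "v \<in> neighbours G c"
  shows "v \<noteq> c" and "v \<in> fst G"
  using assms by (auto simp: neighbours_def doubleton_eq_iff elim: simple_graph_edgeE)

lemma inj_on_neighbours:
  assumes "simple_graph G" "inj_on (edge_weight \<phi>) (snd G)"
  shows "inj_on \<phi> (neighbours G c)"
proof (rule inj_onI)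
  fix u v assume uv: "u \<in> neighbours G c" "v \<in> neighbours G c" and "\<phi> u = \<phi> v"
  then have "edge_weight \<phi> {c, u} = edge_weight \<phi> {c, v}"
    using neighbours_simple_graph(1)[OF assms(1)] by (metis edge_weight_edge)
  then have "{c, u} = {c, v}"
    using inj_onD[OF assms(2)] uv by (simp add: neighbours_def)
  then show "u = v"
    by (auto simp: doubleton_eq_iff)
qed

theorem card_neighbours_le_es:
  assumes "finite (fst G)" "simple_graph G"
  shows "card (neighbours G c) \<le> es G"
proof -
  obtain \<phi> where lab: "vertex_labeling G (es G) \<phi>" and inj: "inj_on (edge_weight \<phi>) (snd G)"
    using assms by (rule es_labelingE)
  have "\<phi> ` neighbours G c \<subseteq> {1..es G}"
    using lab neighbours_simple_graph(2)[OF assms(2)] unfolding vertex_labeling_def by blast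
  with inj_on_neighbours[OF assms(2) inj] have "card (neighbours G c) \<le> card {1..es G}"
    by (intro card_inj_on_le) simp_all
  then show ?thesis
    by simp
qed

text \<open>Each edge of a cycle-star graph joins a unique vertex to its successor, so the vertices index
  the edges.\<close>

definition cycle_star_succ :: "nat \<Rightarrow> nat \<Rightarrow> nat" where
  "cycle_star_succ k i = (if i < k then (i + 1) mod k else 0)"

lemma edges_cycle_star:
  "snd (cycle_star k m) = (\<lambda>i. {i, cycle_star_succ k i}) ` {..<k + m}"
proof -
  have "{{i, (i + 1) mod k} | i. i < k} = (\<lambda>i. {i, cycle_star_succ k i}) ` {..<k}"
    by (auto simp: cycle_star_succ_def)
  moreover have "{{0, j} | j. k \<le> j \<and> j < k + m} = (\<lambda>i. {i, cycle_star_succ k i}) ` {k..<k + m}"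
    by (force simp: cycle_star_succ_def insert_commute)
  moreover have "{..<k + m} = {..<k} \<union> {k..<k + m}"
    by auto
  ultimately show ?thesis
    by (simp only: cycle_star_def snd_conv image_Un)
qed

lemma cycle_star_succ_neq:
  assumes "k \<ge> 2"
  shows "cycle_star_succ k i \<noteq> i"
  using assms by (auto simp: cycle_star_succ_def mod_Suc)

lemma cycle_star_succ_succ_neq:
  assumes "k \<ge> 3"
  shows "cycle_star_succ k (cycle_star_succ k i) \<noteq> i"
  using assms by (auto simp: cycle_star_succ_def mod_Suc)

lemma cycle_star_succ_eq_0_iff:
  assumes "k \<ge> 1"
  shows "cycle_star_succ k i = 0 \<longleftrightarrow> k - 1 \<le> i"
  using assms by (auto simp: cycle_star_succ_def mod_Suc)

lemma inj_cycle_star_edge: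
  assumes "k \<ge> 3"
  shows "inj (\<lambda>i. {i, cycle_star_succ k i})"
  using cycle_star_succ_succ_neq[OF assms] by (intro injI) (metis doubleton_eq_iff)

lemma card_edges_cycle_star:
  assumes "k \<ge> 3"
  shows "card (snd (cycle_star k m)) = k + m"
  using inj_on_subset[OF inj_cycle_star_edge[OF assms] subset_UNIV]
  by (simp add: edges_cycle_star card_image)

lemma neighbours_cycle_star_centre:
  assumes "k \<ge> 3"
  shows "neighbours (cycle_star k m) 0 = insert 1 {k - 1..<k + m}"
proof (rule set_eqI)
  fix v
  have "cycle_star_succ k 0 = 1"
    using assms by (simp add: cycle_star_succ_def)
  have "v \<in> neighbours (cycle_star k m) 0 \<longleftrightarrow> (\<exists>i<k + m. {0, v} = {i, cycle_star_succ k i})"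
    by (auto simp: neighbours_def edges_cycle_star)
  also have "\<dots> \<longleftrightarrow> (\<exists>i<k + m. i = 0 \<and> v = cycle_star_succ k i \<or> i = v \<and> cycle_star_succ k i = 0)"
    by (auto simp: doubleton_eq_iff)
  also have "\<dots> \<longleftrightarrow> v = cycle_star_succ k 0 \<or> v < k + m \<and> cycle_star_succ k v = 0"
    using assms by (simp add: conj_disj_distribL ex_disj_distrib)
  also have "\<dots> \<longleftrightarrow> v \<in> insert 1 {k - 1..<k + m}"
    using assms \<open>cycle_star_succ k 0 = 1\<close> by (auto simp: cycle_star_succ_eq_0_iff)
  finally show "v \<in> neighbours (cycle_star k m) 0 \<longleftrightarrow> v \<in> insert 1 {k - 1..<k + m}" .
qed

theorem es_cycle_star_ge:
  assumes "k \<ge> 3"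
  shows "max (m + 2) ((k + m + 2) div 2) \<le> es (cycle_star k m)"
proof -
  have finite_vertices: "finite (fst (cycle_star k m))"
    and simple: "simple_graph (cycle_star k m)"
    using simple_graph_cycle_star[OF assms] by (simp_all add: cycle_star_def)
  have "k + m \<le> 2 * es (cycle_star k m) - 1"
    using card_edges_le_es[OF finite_vertices simple] by (simp add: card_edges_cycle_star[OF assms])
  moreover have "m + 2 \<le> es (cycle_star k m)"
    using card_neighbours_le_es[OF finite_vertices simple, of 0] assms
    by (simp add: neighbours_cycle_star_centre)
  ultimately show ?thesis
    by linarith
qed

lemma edge_irregular_labeling_cycle_starI:
  assumes "k \<ge> 2" "\<And>i. i < k + m \<Longrightarrow> \<phi> i \<in> {1..s}"
    and "inj_on (\<lambda>i. \<phi> i + \<phi> (cycle_star_succ k i)) {..<k + m}"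
  shows "edge_irregular_labeling (cycle_star k m) s \<phi>"
proof -
  have "edge_weight \<phi> {i, cycle_star_succ k i} = \<phi> i + \<phi> (cycle_star_succ k i)" for i
    using cycle_star_succ_neq[OF assms(1)] by (metis edge_weight_edge)
  with assms(3) have "inj_on (edge_weight \<phi> \<circ> (\<lambda>i. {i, cycle_star_succ k i})) {..<k + m}"
    by (simp add: comp_def)
  then have "inj_on (edge_weight \<phi>) (snd (cycle_star k m))"
    unfolding edges_cycle_star by (rule inj_on_imageI)
  with assms(2) show ?thesis
    by (simp add: edge_irregular_labeling_def vertex_labeling_def cycle_star_def)
qed

lemma es_cycle_star_7_le_5:
  assumes "m \<le> 2"
  shows "es (cycle_star 7 m) \<le> 5"
proof (rule es_le, rule edge_irregular_labeling_cycle_starI)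
  let ?labels = "[3, 5, 5, 4, 2, 1, 1, 2, 4] :: nat list"
  let ?w = "\<lambda>i. ?labels ! i + ?labels ! cycle_star_succ 7 i"
  show "?labels ! i \<in> {1..5}" if "i < 7 + m" for i
  proof -
    have "?labels ! i \<in> set ?labels"
      using that assms by (intro nth_mem) simp
    then show ?thesis
      by auto
  qed
  have weights: "map ?w [0..<9] = [8, 10, 9, 6, 3, 2, 4, 5, 7]"
    by (simp add: upt_rec cycle_star_succ_def)
  have "inj_on ?w {..<9}"
    using arg_cong[OF weights, of distinct] by (simp add: distinct_map atLeast0LessThan)
  then show "inj_on ?w {..<7 + m}"
    by (rule inj_on_subset) (use assms in auto)
qed simp

lemma es_cycle_star_7_le_max:
  "es (cycle_star 7 m) \<le> max 6 (m + 2)"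
proof (rule es_le, rule edge_irregular_labeling_cycle_starI)
  let ?labels = "[6, 5, 1, 1, 2, 2, 3, 1, 2, 4] :: nat list"
  define \<phi> where "\<phi> i = (if i < 10 then ?labels ! i else i - 4)" for i
  let ?w = "\<lambda>i. \<phi> i + \<phi> (cycle_star_succ 7 i)"
  show "\<phi> i \<in> {1..max 6 (m + 2)}" if "i < 7 + m" for i
  proof (cases "i < 10")
    case True
    then have "\<phi> i \<in> set ?labels"
      unfolding \<phi>_def by (simp only: if_True) (rule nth_mem, simp)
    then show ?thesis
      by auto
  next
    case False
    with that show ?thesis
      by (auto simp: \<phi>_def)
  qed
  have weights_less_10: "map ?w [0..<10] = [11, 6, 2, 3, 4, 5, 9, 7, 8, 10]"
    by (simp add: upt_rec cycle_star_succ_def \<phi>_def)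
  have weights_ge_10: "?w i = i + 2" if "i \<ge> 10" for i
    using that by (simp add: cycle_star_succ_def \<phi>_def)
  have "?w ` {..<10} \<subseteq> {..<12}"
    using arg_cong[OF weights_less_10, of set] by (simp add: atLeast0LessThan)
  moreover have "?w ` {10..} \<subseteq> {12..}"
    using weights_ge_10 by auto
  ultimately have "?w ` {..<10} \<inter> ?w ` {10..} = {}"
    by fastforce
  moreover have "inj_on ?w {..<10}"
    using arg_cong[OF weights_less_10, of distinct] by (simp add: distinct_map atLeast0LessThan)
  moreover have "inj_on ?w {10..}"
    by (rule inj_onI) (simp add: weights_ge_10)
  ultimately have "inj_on ?w ({..<10} \<union> {10..})"
    unfolding inj_on_Un by blast
  then show "inj_on ?w {..<7 + m}"
    by (rule inj_on_subset) auto
qed simp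

theorem es_cycle_star_7:
  assumes "m \<ge> 1"
  shows "es (cycle_star 7 m) = max (m + 2) ((m + 9) div 2)"
proof (rule antisym)
  show "es (cycle_star 7 m) \<le> max (m + 2) ((m + 9) div 2)"
  proof (cases "m \<le> 2")
    case True
    with assms have "max (m + 2) ((m + 9) div 2) = 5"
      by auto
    with es_cycle_star_7_le_5[OF True] show ?thesis
      by simp
  next
    case False
    then have "max (m + 2) ((m + 9) div 2) = max 6 (m + 2)"
      by linarith
    with es_cycle_star_7_le_max show ?thesis
      by simp
  qed
  show "max (m + 2) ((m + 9) div 2) \<le> es (cycle_star 7 m)"
    using es_cycle_star_ge[of 7 m] by (simp add: add.commute)
qed

theorem theorem3p6:
  fixes n :: nat
  assumes "n \<ge> 8"
  shows "es (cycle_star 7 (n - 7)) =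
    (if n = 8 then n - 3 else if n \<in> {9, 10} then n - 4 else n - 5)"
proof -
  have "es (cycle_star 7 (n - 7)) = max (n - 5) ((n + 2) div 2)"
    using es_cycle_star_7[of "n - 7"] assms by simp
  also have "\<dots> = (if n = 8 then n - 3 else if n \<in> {9, 10} then n - 4 else n - 5)"
    using assms by auto
  finally show ?thesis .
qed

end
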